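(* Let $d\ge 2$ and $N\ge 1$ be integers. There is a constant $C_{d,N}$ depending only on $d$ and $N$ such that the following holds. Let $I=[a,b]$ be an interval and let $f$ be a smooth real-valued function on $I$ satisfying $|f^{(N)}|\ge 1$ on $I$, where if $N=1$ we assume in addition that $f'$ is monotone on $I$. Then for every polynomial $P\in\mathbb{R}[x]$ of degree $d$ such that $P'$ is monic or an SND polynomial, and for all real $\lambda$ with $|\lambda|\ge 1$, $$\left|\int_I e^{i\lambda P(f(x))}\,dx\right|\le C_{d,N}|\lambda|^{-1/(Nd)}.$$ In particular, $C_{d,N}$ does not depend on $f$ or $I$.
   Context: A polynomial $Q\in\mathbb{R}[x]$ of degree $m$, $Q(x)=a_mx^m+a_{m-1}x^{m-1}+\ldots+a_1x+a_0$, is called semi-non-degenerating (SND) if $\max_{0\le j\le m}|a_{m-j}|=1$ and this maximum is attained by some $j$ with $j\le m/2$. (Here this is applied to $Q=P'$, so $m=d-1$.) *)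

theory Defs
  imports "HOL-Analysis.Analysis" "HOL-Computational_Algebra.Polynomial"
begin

(* Derivatives are taken within S, hence one-sided at the endpoints of a closed interval;
   they are uniquely determined on a nondegenerate interval, and values of f outside S
   are irrelevant to values at points of S. *)
primrec nth_deriv_within :: "real set \<Rightarrow> nat \<Rightarrow> (real \<Rightarrow> real) \<Rightarrow> real \<Rightarrow> real" where
  "nth_deriv_within S 0 f = f"
| "nth_deriv_within S (Suc n) f =
     (\<lambda>x. vector_derivative (nth_deriv_within S n f) (at x within S))"

definition smooth_within :: "real set \<Rightarrow> (real \<Rightarrow> real) \<Rightarrow> bool" where
  "smooth_within S f \<longleftrightarrow> (\<forall>n. nth_deriv_within S n f differentiable_on S)"

definition monic :: "real poly \<Rightarrow> bool" where
  "monic Q \<longleftrightarrow> lead_coeff Q = 1"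

definition SND :: "real poly \<Rightarrow> bool" where
  "SND Q \<longleftrightarrow>
     (let m = degree Q in
        Max ((\<lambda>j. \<bar>coeff Q (m - j)\<bar>) ` {0..m}) = 1 \<and>
        (\<exists>j\<le>m. real j \<le> real m / 2 \<and> \<bar>coeff Q (m - j)\<bar> = 1))"

end

theory Submission
  imports Defs
begin

text \<open>
  Put \<open>Q = P'\<close>, \<open>m = d - 1\<close> and \<open>\<tau> = \<bar>\<lambda>\<bar> powr (-1/(Nd))\<close>. By Rolle's theorem boundedly many points cut \<open>I\<close>
  into intervals on which \<open>f'\<close> and \<open>Q \<circ> f\<close> are monotone and neither \<open>\<bar>f'\<bar> - \<tau>^(N-1)\<close> nor
  \<open>\<bar>Q \<circ> f\<bar> - \<tau>^(Nm)\<close> changes sign. If \<open>\<bar>f'\<bar> \<le> \<tau>^(N-1)\<close> on a piece, finite differences of \<open>f'\<close>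
  bound its length by \<open>O(\<tau>)\<close>. If \<open>\<bar>Q \<circ> f\<bar> \<le> \<tau>^(Nm)\<close>, then \<open>f\<close> maps the piece into an interval
  of length \<open>O(\<tau>^N)\<close>, because an interval with \<open>\<bar>Q\<bar> \<le> \<rho>^m\<close> and \<open>\<rho> \<le> 1\<close> has length \<open>O(\<rho>)\<close>, and
  finite differences of \<open>f\<close> again bound the length of the piece by \<open>O(\<tau>)\<close>. Otherwise integrate by
  parts against \<open>1 / (Q(f) f')\<close>, a product of two monotone functions whose total variation is at most
  \<open>4 / (\<tau>^(Nm) \<tau>^(N-1)) = 4 \<bar>\<lambda>\<bar> \<tau>\<close>.
\<close>

subsection \<open>Functions with a large derivative of higher order\<close>

text \<open>Keeping the successive derivatives as a sequence lets the same estimates serve for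
  \<open>f\<close>, for its finite differences, for the chain started at \<open>f'\<close> and for
  iterated \<open>pderiv\<close>.\<close>

definition deriv_chain :: "real set \<Rightarrow> nat \<Rightarrow> (nat \<Rightarrow> real \<Rightarrow> real) \<Rightarrow> bool" where
  "deriv_chain S n F \<longleftrightarrow>
     (\<forall>i<n. \<forall>x\<in>S. (F i has_real_derivative F (Suc i) x) (at x within S))"

lemma deriv_chain_subset: "deriv_chain S n F \<Longrightarrow> T \<subseteq> S \<Longrightarrow> deriv_chain T n F"
  unfolding deriv_chain_def by (meson DERIV_subset subsetD)

lemma deriv_chain_shift:
  assumes "deriv_chain {u..w} n F" "v + h \<le> w" "u \<le> u + h"
  shows "deriv_chain {u..v} n (\<lambda>i x. F i (x + h) - F i x)"
  unfolding deriv_chain_def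
proof (intro allI impI ballI)
  fix i x assume i: "i < n" and x: "x \<in> {u..v}"
  have sub: "{u..v} \<subseteq> {u..w}" "(\<lambda>x. x + h) ` {u..v} \<subseteq> {u..w}"
    using assms by auto
  have 1: "(F i has_real_derivative F (Suc i) x) (at x within {u..v})"
    using assms(1) i x sub unfolding deriv_chain_def by (meson DERIV_subset subsetD)
  have "(F i has_real_derivative F (Suc i) (x + h)) (at (x + h) within (\<lambda>x. x + h) ` {u..v})"
    using assms(1) i x sub unfolding deriv_chain_def by (meson DERIV_subset subsetD imageI)
  moreover have shift: "((\<lambda>x. x + h) has_real_derivative 1) (at x within {u..v})"
    by (auto intro!: derivative_eq_intros)
  ultimately have 2: "((\<lambda>x. F i (x + h)) has_real_derivative F (Suc i) (x + h)) (at x within {u..v})"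
    using DERIV_image_chain[of "F i" "F (Suc i) (x + h)" "\<lambda>x. x + h" x "{u..v}" 1, OF _ shift]
    by (simp add: o_def)
  show "((\<lambda>x. F i (x + h) - F i x) has_real_derivative F (Suc i) (x + h) - F (Suc i) x)
          (at x within {u..v})"
    using DERIV_diff[OF 2 1] .
qed

lemma deriv_chain_mvt:
  assumes "deriv_chain {u..v} n F" "i < n" "u \<le> x" "x < y" "y \<le> v"
  shows "\<exists>z\<in>{x<..<y}. F i y - F i x = F (Suc i) z * (y - x)"
proof -
  have "\<forall>z\<in>{x..y}. (F i has_derivative (*) (F (Suc i) z)) (at z within {x..y})"
    using deriv_chain_subset[OF assms(1), of "{x..y}"] assms
    unfolding deriv_chain_def has_field_derivative_def by auto
  from mvt_simple[OF \<open>x < y\<close>, of "F i" "\<lambda>z. (*) (F (Suc i) z)"] this show ?thesis by auto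
qed

text \<open>The \<open>n\<close>-th difference of \<open>F 0\<close> with step \<open>h\<close> is \<open>h ^ n\<close> times a value of \<open>F n\<close>.\<close>

lemma deriv_chain_difference_bound:
  assumes "deriv_chain {u..u + real n * h} n F" "h > 0"
    and "\<And>x. x \<in> {u..u + real n * h} \<Longrightarrow> A \<le> \<bar>F n x\<bar>"
    and "\<And>x. x \<in> {u..u + real n * h} \<Longrightarrow> \<bar>F 0 x\<bar> \<le> r"
  shows "A * h ^ n \<le> 2 ^ n * r"
  using assms
proof (induction n arbitrary: F A r)
  case 0
  then show ?case by fastforce
next
  case (Suc n)
  let ?v = "u + real (Suc n) * h"
  \<comment> \<open>One differencing step shortens the chain by one: the bound \<open>A\<close>
    becomes \<open>A * h\<close> by the mean value theorem, and \<open>r\<close> becomes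
    \<open>2 * r\<close>.\<close>
  define G where "G = (\<lambda>i x. F i (x + h) - F i x)"
  have "deriv_chain {u..u + real n * h} (Suc n) G"
    unfolding G_def using Suc.prems(1,2)
    by (intro deriv_chain_shift[of u ?v]) (auto simp: algebra_simps)
  then have chain: "deriv_chain {u..u + real n * h} n G"
    unfolding deriv_chain_def by auto
  have "A * h \<le> \<bar>G n x\<bar>" if x: "x \<in> {u..u + real n * h}" for x
  proof -
    obtain z where "z \<in> {x<..<x + h}" "F n (x + h) - F n x = F (Suc n) z * (x + h - x)"
      using deriv_chain_mvt[OF Suc.prems(1), of n x "x + h"] x Suc.prems(2)
      by (auto simp: algebra_simps)
    moreover from this have "A \<le> \<bar>F (Suc n) z\<bar>"
      using Suc.prems(3)[of z] x by (auto simp: algebra_simps)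
    ultimately show ?thesis
      using Suc.prems(2) by (simp add: G_def abs_mult)
  qed
  moreover have "\<bar>G 0 x\<bar> \<le> 2 * r" if x: "x \<in> {u..u + real n * h}" for x
  proof -
    have "x \<in> {u..?v}" "x + h \<in> {u..?v}" using x Suc.prems(2) by (auto simp: algebra_simps)
    then show ?thesis using Suc.prems(4)[of x] Suc.prems(4)[of "x + h"] by (simp add: G_def)
  qed
  ultimately have "A * h * h ^ n \<le> 2 ^ n * (2 * r)"
    using Suc.IH[OF chain Suc.prems(2)] by blast
  then show ?case by (simp add: algebra_simps)
qed

text \<open>With step \<open>h = (v - u) / n\<close> the \<open>n\<close>-th difference just fits
  into the interval, so \<open>h ^ n \<le> (2 * r) ^ n\<close>, and the length is
  \<open>n * h\<close>.\<close>

lemma interval_length_le: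
  assumes chain: "deriv_chain {u..v} n F" and "n \<ge> 1" "u \<le> v" "A > 0" "r \<ge> 0"
    and lower: "\<And>x. x \<in> {u..v} \<Longrightarrow> A \<le> \<bar>F n x\<bar>"
    and upper: "\<And>x. x \<in> {u..v} \<Longrightarrow> \<bar>F 0 x\<bar> \<le> A * r ^ n"
  shows "v - u \<le> 2 * real n * r"
proof (cases "u = v")
  case True
  then show ?thesis using assms by simp
next
  case False
  define h where "h = (v - u) / real n"
  have h: "h > 0" "v = u + real n * h" using assms False by (auto simp: h_def)
  have "A * h ^ n \<le> 2 ^ n * (A * r ^ n)"
    using chain lower upper unfolding h(2) by (intro deriv_chain_difference_bound h) auto
  then have "h ^ n \<le> (2 * r) ^ n" using \<open>A > 0\<close> by (simp add: power_mult_distrib)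
  then have "h \<le> 2 * r" using \<open>n \<ge> 1\<close> \<open>r \<ge> 0\<close> h(1) power_mono_iff[of h "2 * r" n] by simp
  then have "real n * h \<le> real n * (2 * r)" by (intro mult_left_mono) auto
  then show ?thesis using h by simp
qed

section \<open>Counting zeros, and cutting an interval at finitely many points\<close>

text \<open>Counting the elements of \<open>W\<close> below \<open>z\<close> is strictly increasing in \<open>z \<in> Z\<close>.\<close>

lemma card_le_Suc_of_separated:
  fixes Z W :: "'a::linorder set"
  assumes "finite W" and sep: "\<And>x y. x \<in> Z \<Longrightarrow> y \<in> Z \<Longrightarrow> x < y \<Longrightarrow> \<exists>w\<in>W. x < w \<and> w < y"
  shows "finite Z" "card Z \<le> Suc (card W)"
proof -
  define \<phi> where "\<phi> z = card {w\<in>W. w < z}" for z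
  have less: "\<phi> x < \<phi> y" if xy: "x \<in> Z" "y \<in> Z" "x < y" for x y
  proof -
    obtain w where w: "w \<in> W" "x < w" "w < y" using sep[OF xy] by blast
    have psub: "{w\<in>W. w < x} \<subset> {w\<in>W. w < y}"
    proof (rule psubsetI)
      show "{w\<in>W. w < x} \<subseteq> {w\<in>W. w < y}"
        using \<open>x < y\<close> by (intro Collect_mono) (meson less_trans)
      have "w \<in> {w\<in>W. w < y}" "w \<notin> {w\<in>W. w < x}" using w by (simp_all add: less_imp_not_less)
      then show "{w\<in>W. w < x} \<noteq> {w\<in>W. w < y}" by blast
    qed
    have fin: "finite {w\<in>W. w < y}" using \<open>finite W\<close> by simp
    show ?thesis unfolding \<phi>_def by (rule psubset_card_mono[OF fin psub])
  qed
  have inj: "inj_on \<phi> Z"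
  proof (rule inj_onI)
    fix x y assume "x \<in> Z" "y \<in> Z" "\<phi> x = \<phi> y"
    then show "x = y" using less[of x y] less[of y x] by (cases x y rule: linorder_cases) auto
  qed
  have sub: "\<phi> ` Z \<subseteq> {..card W}" unfolding \<phi>_def using \<open>finite W\<close> by (auto intro: card_mono)
  show "finite Z" using inj sub by (meson finite_atMost finite_imageD finite_subset)
  have "card Z = card (\<phi> ` Z)" using inj by (simp add: card_image)
  also have "\<dots> \<le> card {..card W}" using sub by (intro card_mono) auto
  finally show "card Z \<le> Suc (card W)" by simp
qed

text \<open>Rolle: two zeros of \<open>F 0\<close> are separated by a zero of \<open>F 1\<close>, so
  each step back along the chain adds at most one zero.\<close>

lemma deriv_chain_zeros:
  assumes "deriv_chain {u..v} n F" and "\<And>x. x \<in> {u..v} \<Longrightarrow> F n x \<noteq> 0"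
  shows "finite {x\<in>{u..v}. F 0 x = 0} \<and> card {x\<in>{u..v}. F 0 x = 0} \<le> n"
  using assms
proof (induction n arbitrary: F)
  case 0
  then have "{x\<in>{u..v}. F 0 x = 0} = {}" by auto
  then show ?case by (metis card.empty finite.emptyI le0)
next
  case (Suc n)
  let ?Z = "{x\<in>{u..v}. F 0 x = 0}" and ?W = "{x\<in>{u..v}. F (Suc 0) x = 0}"
  have "deriv_chain {u..v} n (\<lambda>i. F (Suc i))"
    using Suc.prems(1) by (simp add: deriv_chain_def)
  from Suc.IH[OF this] Suc.prems(2) have W: "finite ?W" "card ?W \<le> n" by auto
  have sep: "\<exists>w\<in>?W. x < w \<and> w < y" if xy: "x \<in> ?Z" "y \<in> ?Z" "x < y" for x y
  proof -
    obtain w where "w \<in> {x<..<y}" "F 0 y - F 0 x = F (Suc 0) w * (y - x)"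
      using deriv_chain_mvt[OF Suc.prems(1), of 0 x y] xy by auto
    then show ?thesis using xy by (intro bexI[of _ w]) auto
  qed
  have "finite ?Z" "card ?Z \<le> Suc (card ?W)"
    using card_le_Suc_of_separated[of ?W ?Z, OF W(1) sep] by blast+
  then show ?case using W(2) by linarith
qed

text \<open>Zeros are excluded only in the open interval, so that break points may be endpoints. The
  sign found inside extends to the closure.\<close>

lemma continuous_nonzero_sign:
  fixes g :: "real \<Rightarrow> real"
  assumes cont: "continuous_on {u..v} g" and "u < v" and nz: "\<And>x. x \<in> {u<..<v} \<Longrightarrow> g x \<noteq> 0"
  shows "(\<forall>x\<in>{u..v}. 0 \<le> g x) \<or> (\<forall>x\<in>{u..v}. g x \<le> 0)"
proof -
  have conn: "connected (g ` {u<..<v})"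
    using cont by (intro connected_continuous_image continuous_on_subset[OF cont]) auto
  have "(\<forall>x\<in>{u<..<v}. 0 \<le> g x) \<or> (\<forall>x\<in>{u<..<v}. g x \<le> 0)"
  proof (rule ccontr)
    assume "\<not> ?thesis"
    then obtain x y where "x \<in> {u<..<v}" "y \<in> {u<..<v}" "g x < 0" "0 < g y" by force
    then have "0 \<in> g ` {u<..<v}"
      using connectedD_interval[OF conn, of "g x" "g y" 0] by auto
    then show False using nz by force
  qed
  moreover have "closure {u<..<v} = {u..v}" using \<open>u < v\<close> by simp
  ultimately show ?thesis
    using continuous_ge_on_closure[of "{u<..<v}" g _ 0] continuous_le_on_closure[of "{u<..<v}" g _ 0] cont
    by metis
qed

text \<open>Splitting at some \<open>c\<close> in \<open>S\<close> inside the interval leaves at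
  most \<open>card ?L + 1\<close> and \<open>card ?R + 1\<close> pieces, together
  \<open>card S + 1\<close>.\<close>

lemma norm_integral_le_pieces:
  fixes g :: "real \<Rightarrow> complex"
  assumes "finite S" "continuous_on {a..b} g" "a \<le> b" "B \<ge> 0"
    and "\<And>u v. a \<le> u \<Longrightarrow> u < v \<Longrightarrow> v \<le> b \<Longrightarrow> {u<..<v} \<inter> S = {} \<Longrightarrow> norm (integral {u..v} g) \<le> B"
  shows "norm (integral {a..b} g) \<le> (real (card S) + 1) * B"
  using assms
proof (induction "card S" arbitrary: S a b rule: less_induct)
  case less
  note pieces = less.prems(5)
  show ?case
  proof (cases "{a<..<b} \<inter> S = {}")
    case True
    have "norm (integral {a..b} g) \<le> B"
      using pieces[of a b] True less.prems(3,4) by (cases "a = b") auto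
    also have "B \<le> (real (card S) + 1) * B" using \<open>B \<ge> 0\<close> by (simp add: algebra_simps)
    finally show ?thesis .
  next
    case False
    then obtain c where c: "a < c" "c < b" "c \<in> S" by auto
    let ?L = "{x\<in>S. x < c}" and ?R = "{x\<in>S. c < x}"
    have fin: "finite ?L" "finite ?R" using less.prems(1) by auto
    have split: "S = insert c (?L \<union> ?R)" using c by auto
    have "card S = Suc (card ?L + card ?R)"
      by (subst split) (use fin in \<open>auto simp: card_Un_disjoint disjoint_iff\<close>)
    moreover have "norm (integral {a..c} g) \<le> (real (card ?L) + 1) * B"
    proof (rule less.hyps)
      show "continuous_on {a..c} g" using less.prems(2) c by (auto intro: continuous_on_subset)
      fix u v assume "a \<le> u" "u < v" "v \<le> c" "{u<..<v} \<inter> ?L = {}"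
      then show "norm (integral {u..v} g) \<le> B" using c by (intro pieces) auto
    qed (use fin c \<open>B \<ge> 0\<close> calculation in auto)
    moreover have "norm (integral {c..b} g) \<le> (real (card ?R) + 1) * B"
    proof (rule less.hyps)
      show "continuous_on {c..b} g" using less.prems(2) c by (auto intro: continuous_on_subset)
      fix u v assume "c \<le> u" "u < v" "v \<le> b" "{u<..<v} \<inter> ?R = {}"
      then show "norm (integral {u..v} g) \<le> B" using c by (intro pieces) auto
    qed (use fin c \<open>B \<ge> 0\<close> calculation in auto)
    moreover have "integral {a..b} g = integral {a..c} g + integral {c..b} g"
      using c less.prems(2) Henstock_Kurzweil_Integration.integral_combine[of a c b g]
      by (simp add: integrable_continuous_real)
    moreover have "norm (integral {a..c} g + integral {c..b} g)
        \<le> norm (integral {a..c} g) + norm (integral {c..b} g)" by (rule norm_triangle_ineq)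
    ultimately show ?thesis by (simp add: algebra_simps)
  qed
qed

subsection \<open>Sublevel sets of polynomials\<close>

lemma deriv_chain_poly: "deriv_chain S n (\<lambda>i. poly ((pderiv ^^ i) Q))"
  unfolding deriv_chain_def by (auto intro: DERIV_subset[OF poly_DERIV])

text \<open>Divide by \<open>x - s\<close>: on the right half of the interval \<open>x - s\<close>
  is at least \<open>L / 2\<close>, so the quotient is bounded by \<open>4 * \<delta> / L\<close>
  and has lower degree. The bound \<open>C\<close> on \<open>s\<close> controls the passage back
  from the coefficients of the quotient to those of \<open>p\<close>.\<close>

lemma coeff_bound_of_interval_bound:
  fixes C :: real
  assumes "C \<ge> 1"
  shows "\<exists>K>0. \<forall>(p::real poly) s t \<delta> k. degree p \<le> n \<longrightarrow> -C \<le> s \<longrightarrow> s < t \<longrightarrow> t \<le> C \<longrightarrow>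
           (\<forall>x\<in>{s..t}. \<bar>poly p x\<bar> \<le> \<delta>) \<longrightarrow> \<bar>coeff p k\<bar> * (t - s) ^ n \<le> K * \<delta>"
proof (induction n)
  case 0
  have "\<bar>coeff p k\<bar> \<le> \<delta>" if "degree p \<le> 0" "s < t" "\<forall>x\<in>{s..t}. \<bar>poly p x\<bar> \<le> \<delta>"
    for p :: "real poly" and s t \<delta> :: real and k
  proof -
    obtain c where c: "p = [:c:]" using \<open>degree p \<le> 0\<close> by (metis degree_eq_zeroE le_zero_eq)
    have "\<bar>c\<bar> \<le> \<delta>" using that(2,3) c by (auto dest!: bspec[of _ _ s])
    then show ?thesis using c by (cases k) auto
  qed
  then show ?case by (intro exI[of _ 1]) auto
next
  case (Suc n)
  then obtain K where "K > 0"
    and K: "\<And>(p::real poly) s t \<delta> k. degree p \<le> n \<Longrightarrow> -C \<le> s \<Longrightarrow> s < t \<Longrightarrow> t \<le> C \<Longrightarrow>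
           (\<forall>x\<in>{s..t}. \<bar>poly p x\<bar> \<le> \<delta>) \<Longrightarrow> \<bar>coeff p k\<bar> * (t - s) ^ n \<le> K * \<delta>"
    by blast
  \<comment> \<open>The first summand pays for the value \<open>poly p s\<close> in coefficient 0,
    as \<open>L \<le> 2 * C\<close>; the second for the two quotient coefficients that enter
    \<open>coeff p k\<close>, one of them multiplied by \<open>s\<close>.\<close>
  define K' where "K' = (2 * C) ^ Suc n + (1 + C) * (4 * 2 ^ n * K)"
  have "\<bar>coeff p k\<bar> * (t - s) ^ Suc n \<le> K' * \<delta>"
    if deg: "degree p \<le> Suc n" and st: "-C \<le> s" "s < t" "t \<le> C"
      and bd: "\<forall>x\<in>{s..t}. \<bar>poly p x\<bar> \<le> \<delta>" for p :: "real poly" and s t \<delta> k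
  proof -
    define L where "L = t - s"
    define q where "q = synthetic_div p s"
    have L: "0 < L" "L \<le> 2 * C" using st by (auto simp: L_def)
    have "t = s + L" by (simp add: L_def)
    then have mid: "-C \<le> s + L / 2" "s + L / 2 < t" using st L by linarith+
    have ps: "\<bar>poly p s\<bar> \<le> \<delta>" using bd st by auto
    then have "\<delta> \<ge> 0" by linarith
    have p: "p = pCons (poly p s) q - smult s q"
      using synthetic_div_correct[of p s] unfolding q_def by (metis add_diff_cancel_right')
    have "\<bar>poly q x\<bar> \<le> 4 * \<delta> / L" if x: "x \<in> {s + L / 2..t}" for x
    proof -
      have x': "L / 2 \<le> x - s" "x \<in> {s..t}" using x L by auto
      have "poly p x = poly p s + (x - s) * poly q x"
        by (subst p) (simp add: algebra_simps)
      then have "(x - s) * \<bar>poly q x\<bar> = \<bar>poly p x - poly p s\<bar>"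
        using x' L by (simp add: abs_mult)
      also have "\<dots> \<le> 2 * \<delta>" using bd x' ps by fastforce
      finally have "(x - s) * \<bar>poly q x\<bar> \<le> 2 * \<delta>" .
      moreover have "L / 2 * \<bar>poly q x\<bar> \<le> (x - s) * \<bar>poly q x\<bar>"
        using x' by (intro mult_right_mono) auto
      ultimately show ?thesis using L by (simp add: field_simps)
    qed
    then have bd_q: "\<forall>x\<in>{s + L / 2..t}. \<bar>poly q x\<bar> \<le> 4 * \<delta> / L" by blast
    have "\<bar>coeff q j\<bar> * (t - (s + L / 2)) ^ n \<le> K * (4 * \<delta> / L)" for j
    proof (rule K)
      show "degree q \<le> n" using deg by (simp add: q_def degree_synthetic_div)
    qed (use st L mid bd_q in auto)
    moreover have half: "t - (s + L / 2) = L / 2" using \<open>t = s + L\<close> by simp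
    ultimately have "\<bar>coeff q j\<bar> * (L / 2) ^ n \<le> K * (4 * \<delta> / L)" for j
      unfolding half by blast
    then have cq: "\<bar>coeff q j\<bar> * L ^ Suc n \<le> 4 * 2 ^ n * K * \<delta>" for j
      using L by (simp add: field_simps power_divide)
    have "\<bar>coeff p k\<bar> \<le> \<bar>coeff (pCons (poly p s) q) k\<bar> + C * \<bar>coeff q k\<bar>"
    proof -
      have "coeff p k = coeff (pCons (poly p s) q) k - s * coeff q k" by (subst p) simp
      moreover have "\<bar>s * coeff q k\<bar> \<le> C * \<bar>coeff q k\<bar>"
        unfolding abs_mult using st by (intro mult_right_mono) auto
      ultimately show ?thesis by linarith
    qed
    then have "\<bar>coeff p k\<bar> * L ^ Suc n
        \<le> (\<bar>coeff (pCons (poly p s) q) k\<bar> + C * \<bar>coeff q k\<bar>) * L ^ Suc n"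
      using L by (intro mult_right_mono) auto
    also have "\<dots> = \<bar>coeff (pCons (poly p s) q) k\<bar> * L ^ Suc n + C * (\<bar>coeff q k\<bar> * L ^ Suc n)"
      by (simp add: algebra_simps)
    also have "\<dots> \<le> ((2 * C) ^ Suc n * \<delta> + 4 * 2 ^ n * K * \<delta>) + C * (4 * 2 ^ n * K * \<delta>)"
    proof (intro add_mono mult_left_mono cq)
      show "\<bar>coeff (pCons (poly p s) q) k\<bar> * L ^ Suc n \<le> (2 * C) ^ Suc n * \<delta> + 4 * 2 ^ n * K * \<delta>"
      proof (cases k)
        case 0
        have "L ^ Suc n * \<bar>poly p s\<bar> \<le> (2 * C) ^ Suc n * \<delta>"
          using ps L by (intro mult_mono power_mono) auto
        moreover have "0 \<le> 4 * 2 ^ n * K * \<delta>" using \<open>K > 0\<close> \<open>\<delta> \<ge> 0\<close> by simp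
        ultimately show ?thesis
          unfolding 0 coeff_pCons_0 mult.commute[of "\<bar>poly p s\<bar>"] by linarith
      next
        case (Suc j)
        have "0 \<le> (2 * C) ^ Suc n * \<delta>" using \<open>C \<ge> 1\<close> \<open>\<delta> \<ge> 0\<close> by simp
        then show ?thesis using cq[of j] unfolding Suc coeff_pCons_Suc by linarith
      qed
    qed (use \<open>C \<ge> 1\<close> in auto)
    finally show ?thesis by (simp add: K'_def L_def algebra_simps)
  qed
  moreover have "K' > 0" using \<open>K > 0\<close> \<open>C \<ge> 1\<close> by (simp add: K'_def add_pos_nonneg)
  ultimately show ?case by blast
qed

text \<open>Take \<open>\<delta> = \<rho> ^ m\<close> in the coefficient bound and extract
  \<open>m\<close>-th roots; \<open>max 1 K\<close> dominates the \<open>m\<close>-th root of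
  \<open>K\<close>.\<close>

lemma sublevel_interval_bounded:
  fixes C :: real
  assumes "C \<ge> 1" "m \<ge> 1"
  shows "\<exists>K>0. \<forall>(Q::real poly) s t \<rho>. degree Q = m \<longrightarrow> (\<exists>k. 1 \<le> \<bar>coeff Q k\<bar>) \<longrightarrow> 0 \<le> \<rho> \<longrightarrow>
           -C \<le> s \<longrightarrow> s \<le> t \<longrightarrow> t \<le> C \<longrightarrow> (\<forall>x\<in>{s..t}. \<bar>poly Q x\<bar> \<le> \<rho> ^ m) \<longrightarrow> t - s \<le> K * \<rho>"
proof -
  obtain K where "K > 0"
    and K: "\<And>(p::real poly) s t \<delta> k. degree p \<le> m \<Longrightarrow> -C \<le> s \<Longrightarrow> s < t \<Longrightarrow> t \<le> C \<Longrightarrow>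
           (\<forall>x\<in>{s..t}. \<bar>poly p x\<bar> \<le> \<delta>) \<Longrightarrow> \<bar>coeff p k\<bar> * (t - s) ^ m \<le> K * \<delta>"
    using coeff_bound_of_interval_bound[OF \<open>C \<ge> 1\<close>, of m] by blast
  have "t - s \<le> max 1 K * \<rho>"
    if Q: "degree Q = m" "1 \<le> \<bar>coeff Q k\<bar>" and "0 \<le> \<rho>" and st: "-C \<le> s" "s \<le> t" "t \<le> C"
      and small: "\<forall>x\<in>{s..t}. \<bar>poly Q x\<bar> \<le> \<rho> ^ m" for Q :: "real poly" and s t \<rho> k
  proof (cases "s = t")
    case True
    then show ?thesis using \<open>0 \<le> \<rho>\<close> by simp
  next
    case False
    have "(t - s) ^ m \<le> \<bar>coeff Q k\<bar> * (t - s) ^ m"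
      using Q(2) st by (simp add: mult_le_cancel_right1)
    also have "\<dots> \<le> K * \<rho> ^ m" using Q st small False by (intro K) auto
    also have "\<dots> \<le> max 1 K ^ m * \<rho> ^ m"
    proof (intro mult_right_mono)
      have "max 1 K ^ 1 \<le> max 1 K ^ m" using \<open>m \<ge> 1\<close> by (intro power_increasing) auto
      then show "K \<le> max 1 K ^ m" by simp
    qed (use \<open>0 \<le> \<rho>\<close> in auto)
    finally have "(t - s) ^ m \<le> (max 1 K * \<rho>) ^ m" by (simp add: power_mult_distrib)
    then show ?thesis
      using power_mono_iff[of "t - s" "max 1 K * \<rho>" m] st \<open>m \<ge> 1\<close> \<open>0 \<le> \<rho>\<close> by simp
  qed
  then show ?thesis by (intro exI[of _ "max 1 K"]) auto
qed

text \<open>At 0 the \<open>k\<close>-th derivative is \<open>k!\<close> times a coefficient of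
  modulus 1. Its other coefficients are at most \<open>(m + 1) ^ m\<close>, so for such
  \<open>w\<close> the remaining terms sum to at most 1/2.\<close>

lemma higher_pderiv_lower_bound:
  fixes R :: "real poly"
  assumes deg: "degree R \<le> m" and "\<And>i. \<bar>coeff R i\<bar> \<le> 1" and "\<bar>coeff R k\<bar> = 1" and "k \<le> m"
    and w: "\<bar>w\<bar> \<le> 1 / (2 * real (Suc m) ^ Suc m)"
  shows "1 / 2 \<le> \<bar>poly ((pderiv ^^ k) R) w\<bar>"
proof -
  define D where "D = (pderiv ^^ k) R"
  define M where "M = real (Suc m) ^ m"
  obtain a E where D: "D = pCons a E" by (cases D)
  have coeff_D: "coeff D n = pochhammer (real (Suc n)) k * coeff R (n + k)" for n
    by (simp add: D_def coeff_higher_pderiv)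
  have "a = fact k * coeff R k" using coeff_D[of 0] D by (simp add: pochhammer_fact)
  then have a: "\<bar>a\<bar> \<ge> 1" using assms(3) by (simp add: abs_mult fact_ge_1)
  have bound_D: "\<bar>coeff D n\<bar> \<le> M" for n
  proof (cases "n + k \<le> m")
    case True
    \<comment> \<open>The factors run from \<open>n + 1\<close> to \<open>n + k\<close>, which is at
      most \<open>m\<close>.\<close>
    have "pochhammer (real (Suc n)) k = (\<Prod>i<k. real (Suc n) + real i)"
      by (simp add: pochhammer_prod lessThan_atLeast0)
    also have "\<dots> \<le> (\<Prod>i<k. real (Suc m))" using True by (intro prod_mono) auto
    also have "\<dots> \<le> M" using True by (simp add: M_def power_increasing del: of_nat_Suc)
    finally have "\<bar>pochhammer (real (Suc n)) k\<bar> * \<bar>coeff R (n + k)\<bar> \<le> M * 1"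
      using assms(2) by (intro mult_mono) (auto simp: pochhammer_nonneg M_def)
    then show ?thesis by (simp add: coeff_D abs_mult)
  next
    case False
    then show ?thesis using deg by (simp add: coeff_D coeff_eq_0 M_def)
  qed
  have "1 \<le> real (Suc m) ^ Suc m" by (rule one_le_power) simp
  then have "1 / (2 * real (Suc m) ^ Suc m) \<le> 1"
    by (subst divide_le_eq_1_pos) linarith+
  then have "\<bar>w\<bar> \<le> 1" using w by linarith
  have "degree D \<le> m" using deg by (simp add: D_def degree_higher_pderiv)
  then have "degree E \<le> m" using D by (cases "E = 0") auto
  have "\<bar>poly E w\<bar> \<le> (\<Sum>i\<le>degree E. \<bar>coeff E i * w ^ i\<bar>)"
    unfolding poly_altdef by (rule sum_abs)
  also have "\<dots> \<le> (\<Sum>i\<le>degree E. M)"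
  proof (intro sum_mono)
    fix i
    have "\<bar>coeff E i\<bar> * \<bar>w\<bar> ^ i \<le> M * 1"
      using bound_D[of "Suc i"] D \<open>\<bar>w\<bar> \<le> 1\<close> by (intro mult_mono power_le_one) (auto simp: M_def)
    then show "\<bar>coeff E i * w ^ i\<bar> \<le> M" by (simp add: abs_mult power_abs)
  qed
  also have "\<dots> \<le> real (Suc m) * M"
    using \<open>degree E \<le> m\<close> by (simp add: M_def mult_right_mono)
  finally have "\<bar>poly E w\<bar> \<le> real (Suc m) ^ Suc m" by (simp add: M_def)
  then have "\<bar>w\<bar> * \<bar>poly E w\<bar> \<le> 1 / (2 * real (Suc m) ^ Suc m) * real (Suc m) ^ Suc m"
    using w by (intro mult_mono) auto
  also have "\<dots> = 1 / 2" by (simp add: field_simps del: of_nat_Suc power_Suc)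
  finally have "\<bar>w * poly E w\<bar> \<le> 1 / 2" by (simp add: abs_mult)
  moreover have "poly D w = a + w * poly E w" by (simp add: D)
  ultimately show ?thesis
    using a abs_triangle_ineq4[of "a + w * poly E w" "w * poly E w"] by (simp add: D_def)
qed

text \<open>
  In the coordinate \<open>w = 1/x\<close>, the reversed polynomial has \<open>k\<close>-th derivative bounded below near \<open>0\<close>.
  This gives a length \<open>O(\<rho> / u\<^sup>2)\<close> in \<open>w\<close> near \<open>1/u\<close>: the gain \<open>u^(-m/k)\<close> pays for
  the factor \<open>u\<^sup>2\<close> lost in returning to \<open>x\<close> exactly because \<open>k \<le> m/2\<close>.
\<close>

lemma sublevel_interval_far:
  fixes Q :: "real poly"
  assumes deg: "degree Q = m" and le1: "\<And>i. \<bar>coeff Q i\<bar> \<le> 1"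
    and k: "1 \<le> k" "2 * k \<le> m" "\<bar>coeff Q (m - k)\<bar> = 1"
    and st: "2 * real (Suc m) ^ Suc m \<le> s" "s \<le> t" and \<rho>: "0 \<le> \<rho>" "\<rho> \<le> 1"
    and small: "\<And>x. x \<in> {s..t} \<Longrightarrow> \<bar>poly Q x\<bar> \<le> \<rho> ^ m"
  shows "t - s \<le> 16 * real m * \<rho>"
proof -
  define R where "R = reflect_poly Q"
  have R: "degree R \<le> m" "\<And>i. \<bar>coeff R i\<bar> \<le> 1" "\<bar>coeff R k\<bar> = 1"
    using le1 k deg degree_reflect_poly_le[of Q] by (auto simp: R_def coeff_reflect_poly)
  have "1 \<le> real (Suc m) ^ Suc m" by (rule one_le_power) simp
  then have "s > 1" using st(1) by linarith
  \<comment> \<open>On a dyadic range, \<open>1 / u - 1 / v\<close> and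
    \<open>(v - u) / u\<^sup>2\<close> agree up to the factor \<open>v / u \<le> 2\<close>.\<close>
  have narrow: "v - u \<le> 8 * real k * \<rho>" if uv: "s \<le> u" "u \<le> v" "v \<le> t" "v \<le> 2 * u" for u v
  proof -
    have u: "u > 1" "v > 1" using \<open>s > 1\<close> uv by auto
    have lower: "1 / 2 \<le> \<bar>poly ((pderiv ^^ k) R) w\<bar>" if w: "w \<in> {1 / v..1 / u}" for w
    proof (rule higher_pderiv_lower_bound[OF R])
      have "0 < 1 / v" using u by simp
      moreover have "1 / v \<le> w" "w \<le> 1 / u" using w by simp_all
      ultimately have "0 < w" "w \<le> 1 / u" by linarith+
      then have "\<bar>w\<bar> \<le> 1 / u" by simp
      also have "\<dots> \<le> 1 / (2 * real (Suc m) ^ Suc m)"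
        using st(1) uv(1) \<open>1 \<le> real (Suc m) ^ Suc m\<close>
        by (intro frac_le) (auto simp del: of_nat_Suc power_Suc)
      finally show "\<bar>w\<bar> \<le> 1 / (2 * real (Suc m) ^ Suc m)" .
    qed (use k in simp)
    have upper: "\<bar>poly R w\<bar> \<le> 1 / 2 * (2 * \<rho> / u\<^sup>2) ^ k" if w: "w \<in> {1 / v..1 / u}" for w
    proof -
      have "0 < 1 / v" using u by simp
      moreover have "1 / v \<le> w" "w \<le> 1 / u" using w by simp_all
      ultimately have w0: "w > 0" "w \<le> 1 / u" by linarith+
      have "inverse w \<in> {s..t}"
      proof -
        have "u \<le> inverse w" "inverse w \<le> v" using w w0 u by (auto simp: field_simps)
        then show ?thesis using uv by auto
      qed
      have "\<bar>poly R w\<bar> = w ^ m * \<bar>poly Q (inverse w)\<bar>"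
        using w0 deg by (simp add: R_def poly_reflect_poly_nz abs_mult power_abs)
      also have "\<dots> \<le> (1 / u) ^ m * \<rho> ^ m"
        using w0 small[OF \<open>inverse w \<in> {s..t}\<close>] u by (intro mult_mono power_mono) auto
      also have "\<dots> = (\<rho> / u) ^ m" by (simp add: power_divide)
      \<comment> \<open>Here \<open>\<rho> / u \<le> 1\<close> and \<open>2 * k \<le> m\<close> are
        used; afterwards \<open>\<rho>\<^sup>2 \<le> \<rho>\<close> leaves a \<open>k\<close>-th
        power that is linear in \<open>\<rho>\<close> inside.\<close>
      also have "\<dots> \<le> (\<rho> / u) ^ (2 * k)"
        using k u \<rho> by (intro power_decreasing) (auto simp: field_simps)
      also have "\<dots> = ((\<rho> / u)\<^sup>2) ^ k" by (simp add: power_mult)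
      also have "\<dots> \<le> (\<rho> / u\<^sup>2) ^ k"
      proof (intro power_mono)
        have "\<rho>\<^sup>2 \<le> \<rho>" using \<rho> by (simp add: power2_eq_square mult_left_le)
        then show "(\<rho> / u)\<^sup>2 \<le> \<rho> / u\<^sup>2" by (simp add: power_divide divide_right_mono)
      qed auto
      \<comment> \<open>The factor \<open>2 ^ k \<ge> 2\<close> compensates the lower bound 1/2 of
        the derivative, giving the form \<open>A * r ^ n\<close> with
        \<open>A = 1 / 2\<close>.\<close>
      also have "\<dots> \<le> 1 / 2 * (2 ^ k * (\<rho> / u\<^sup>2) ^ k)"
      proof -
        have "(2::real) ^ 1 \<le> 2 ^ k" using k by (intro power_increasing) auto
        then have "2 * (\<rho> / u\<^sup>2) ^ k \<le> 2 ^ k * (\<rho> / u\<^sup>2) ^ k"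
          using \<rho> by (intro mult_right_mono) auto
        then show ?thesis by linarith
      qed
      also have "\<dots> = 1 / 2 * (2 * \<rho> / u\<^sup>2) ^ k" by (simp flip: power_mult_distrib)
      finally show ?thesis .
    qed
    have "1 / u - 1 / v \<le> 2 * real k * (2 * \<rho> / u\<^sup>2)"
      using u uv k \<rho> lower upper
      by (intro interval_length_le[OF deriv_chain_poly[of _ k R], of _ _ "1 / 2"]) (auto simp: frac_le)
    then have "u * v * (1 / u - 1 / v) \<le> u * v * (2 * real k * (2 * \<rho> / u\<^sup>2))"
      using u by (intro mult_left_mono) auto
    moreover have "u * v * (1 / u - 1 / v) = v - u" using u by (simp add: field_simps)
    moreover have "u * v * (2 * real k * (2 * \<rho> / u\<^sup>2)) = v / u * (4 * real k * \<rho>)"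
      using u by (simp add: field_simps power2_eq_square)
    ultimately have "v - u \<le> v / u * (4 * real k * \<rho>)" by simp
    also have "\<dots> \<le> 2 * (4 * real k * \<rho>)"
      using u uv(4) \<rho> by (intro mult_right_mono) (auto simp: field_simps)
    finally show ?thesis by simp
  qed
  have "t - s \<le> 16 * real k * \<rho>"
  proof (cases "t \<le> 2 * s")
    case True
    have "0 \<le> real k * \<rho>" using \<rho> by simp
    then show ?thesis using narrow[of s t] st True by linarith
  next
    case False
    \<comment> \<open>The dyadic interval from \<open>t / 2\<close> to \<open>t\<close> lies in the
      given one, so \<open>t / 2\<close> is at most \<open>8 * k * \<rho>\<close>, and
      \<open>t - s < t\<close>.\<close>
    then show ?thesis using narrow[of "t / 2" t] \<open>s > 1\<close> by auto
  qed
  also have "\<dots> \<le> 16 * real m * \<rho>" using k \<rho> by (intro mult_right_mono) auto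
  finally show ?thesis .
qed

text \<open>A leading coefficient of modulus 1 makes the \<open>m\<close>-th derivative a constant
  of modulus at least 1. Otherwise \<open>Q\<close> is SND with \<open>k \<ge> 1\<close>, and the
  interval is cut at \<open>-C\<close> and \<open>C\<close> into two far parts and a bounded
  one.\<close>

lemma sublevel_interval:
  assumes "m \<ge> 1"
  shows "\<exists>K>0. \<forall>(Q::real poly) s t \<rho>. degree Q = m \<longrightarrow> monic Q \<or> SND Q \<longrightarrow> 0 \<le> \<rho> \<longrightarrow> \<rho> \<le> 1 \<longrightarrow>
           s \<le> t \<longrightarrow> (\<forall>x\<in>{s..t}. \<bar>poly Q x\<bar> \<le> \<rho> ^ m) \<longrightarrow> t - s \<le> K * \<rho>"
proof -
  define C where "C = 2 * real (Suc m) ^ Suc m"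
  have "1 \<le> real (Suc m) ^ Suc m" by (rule one_le_power) simp
  then have "C \<ge> 1" unfolding C_def by linarith
  then obtain K where "K > 0" and bounded: "\<And>(Q::real poly) s t \<rho>. degree Q = m \<Longrightarrow>
      (\<exists>k. 1 \<le> \<bar>coeff Q k\<bar>) \<Longrightarrow> 0 \<le> \<rho> \<Longrightarrow> -C \<le> s \<Longrightarrow> s \<le> t \<Longrightarrow> t \<le> C \<Longrightarrow>
      (\<forall>x\<in>{s..t}. \<bar>poly Q x\<bar> \<le> \<rho> ^ m) \<Longrightarrow> t - s \<le> K * \<rho>"
    using sublevel_interval_bounded[OF \<open>C \<ge> 1\<close> \<open>m \<ge> 1\<close>] by blast
  have "t - s \<le> (K + 32 * real m) * \<rho>"
    if deg: "degree Q = m" and Q: "monic Q \<or> SND Q" and \<rho>: "0 \<le> \<rho>" "\<rho> \<le> 1" and "s \<le> t"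
      and small: "\<forall>x\<in>{s..t}. \<bar>poly Q x\<bar> \<le> \<rho> ^ m" for Q :: "real poly" and s t \<rho>
  proof (cases "\<bar>coeff Q m\<bar> = 1")
    case True
    have "t - s \<le> 2 * real m * \<rho>"
    proof (rule interval_length_le[OF deriv_chain_poly[of _ m Q], of _ _ 1])
      fix x
      have "degree ((pderiv ^^ m) Q) = 0" using deg by (simp add: degree_higher_pderiv)
      then obtain c where c: "(pderiv ^^ m) Q = [:c:]" by (metis degree_eq_zeroE)
      have "c = fact m * coeff Q m"
        using coeff_higher_pderiv[of m Q 0] c by (simp add: pochhammer_fact)
      then show "1 \<le> \<bar>poly ((pderiv ^^ m) Q) x\<bar>"
        using True c by (simp add: abs_mult fact_ge_1)
    qed (use assms \<rho> \<open>s \<le> t\<close> small in auto)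
    also have "\<dots> \<le> (K + 32 * real m) * \<rho>"
      using \<open>K > 0\<close> \<rho> by (intro mult_right_mono) auto
    finally show ?thesis .
  next
    case False
    then have "SND Q" using Q deg by (auto simp: monic_def)
    then obtain k where max: "Max ((\<lambda>j. \<bar>coeff Q (m - j)\<bar>) ` {0..m}) = 1"
      and k: "k \<le> m" "real k \<le> real m / 2" "\<bar>coeff Q (m - k)\<bar> = 1"
      unfolding SND_def Let_def deg by blast
    have "k \<ge> 1" using False k(3) by (cases k) auto
    have "2 * k \<le> m" using k(2) by linarith
    have le1: "\<bar>coeff Q i\<bar> \<le> 1" for i
    proof (cases "i \<le> m")
      case True
      then have "\<bar>coeff Q i\<bar> \<in> (\<lambda>j. \<bar>coeff Q (m - j)\<bar>) ` {0..m}"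
        by (intro image_eqI[of _ _ "m - i"]) auto
      then show ?thesis using max Max_ge[OF finite_imageI[OF finite_atLeastAtMost]] by metis
    next
      case False
      then show ?thesis using deg by (simp add: coeff_eq_0)
    qed
    \<comment> \<open>Reflection preserves the moduli of the coefficients, so the part left of
      \<open>-C\<close> reduces to the one right of \<open>C\<close>.\<close>
    define Q' where "Q' = pcompose Q [:0, -1:]"
    have coeff': "\<bar>coeff Q' i\<bar> = \<bar>coeff Q i\<bar>" for i
      by (simp add: Q'_def coeff_pcompose_linear abs_mult power_abs)
    have Q': "degree Q' = m" "\<And>x. poly Q' x = poly Q (-x)"
      using deg by (auto simp: Q'_def degree_pcompose poly_pcompose)
    \<comment> \<open>Cut points clamped to the interval; any of the three parts may degenerate to a
      point.\<close>
    define p where "p = max s (min t (-C))"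
    define q where "q = max s (min t C)"
    have pq: "s \<le> p" "p \<le> q" "q \<le> t" "s = p \<or> p \<le> -C" "q = t \<or> C \<le> q"
      using \<open>s \<le> t\<close> \<open>C \<ge> 1\<close> by (auto simp: p_def q_def)
    have "t - q \<le> 16 * real m * \<rho>"
    proof (cases "q = t")
      case False
      then show ?thesis
        using pq small unfolding C_def
        by (intro sublevel_interval_far[OF deg le1 \<open>k \<ge> 1\<close> \<open>2 * k \<le> m\<close> k(3)] \<rho>) auto
    qed (use \<rho> in simp)
    moreover have "p - s \<le> 16 * real m * \<rho>"
    proof (cases "s = p")
      case False
      have "-s - -p \<le> 16 * real m * \<rho>"
        using pq small False unfolding C_def
        by (intro sublevel_interval_far[OF Q'(1) _ \<open>k \<ge> 1\<close> \<open>2 * k \<le> m\<close>] \<rho>)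
          (auto simp: coeff' le1 k Q'(2))
      then show ?thesis by simp
    qed (use \<rho> in simp)
    moreover have "q - p \<le> K * \<rho>"
    proof (cases "p = q")
      case False
      then have "-C \<le> p" "q \<le> C" using \<open>C \<ge> 1\<close> by (auto simp: p_def q_def max_def min_def split: if_splits)
      then show ?thesis
        using pq small k(3) by (intro bounded[OF deg _ \<rho>(1)]) (auto intro!: exI[of _ "m - k"])
    qed (use \<rho> \<open>K > 0\<close> in simp)
    ultimately show ?thesis by (simp add: algebra_simps)
  qed
  then show ?thesis using \<open>K > 0\<close> by (intro exI[of _ "K + 32 * real m"]) auto
qed

section \<open>Level sets along a derivative chain\<close>

lemma deriv_chain_shift_index:
  "deriv_chain S n F \<Longrightarrow> m + k \<le> n \<Longrightarrow> deriv_chain S m (\<lambda>i. F (i + k))"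
  by (simp add: deriv_chain_def)

lemma deriv_chain_diff_const:
  "deriv_chain S n F \<Longrightarrow> deriv_chain S n (\<lambda>i x. if i = 0 then F i x - c else F i x)"
proof -
  assume chain: "deriv_chain S n F"
  have "((\<lambda>x. F 0 x - c) has_real_derivative F (Suc 0) x) (at x within S)"
    if "x \<in> S" "0 < n" for x
    using chain that DERIV_diff[OF _ DERIV_const, of "F 0" "F (Suc 0) x" x S c]
    by (simp add: deriv_chain_def)
  then have "((\<lambda>x. if i = 0 then F i x - c else F i x) has_real_derivative F (Suc i) x) (at x within S)"
    if "x \<in> S" "i < n" for i x
    using that chain by (cases i) (simp_all add: deriv_chain_def)
  then show ?thesis by (simp add: deriv_chain_def)
qed

text \<open>Subtracting \<open>c\<close> changes only \<open>F 0\<close>. For \<open>n = 0\<close>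
  it would change the function assumed nonzero, hence \<open>n \<ge> 1\<close>.\<close>

lemma deriv_chain_level_set:
  assumes chain: "deriv_chain {u..v} n F" and "n \<ge> 1" and nz: "\<And>x. x \<in> {u..v} \<Longrightarrow> F n x \<noteq> 0"
  shows "finite {x\<in>{u..v}. F 0 x = c} \<and> card {x\<in>{u..v}. F 0 x = c} \<le> n"
  using deriv_chain_zeros[OF deriv_chain_diff_const[OF chain, of c]] nz \<open>n \<ge> 1\<close> by simp

text \<open>The zero set is the union of the level sets of \<open>F 0\<close> at the roots of
  \<open>R\<close>, so no derivatives of the composition are needed.\<close>

lemma deriv_chain_poly_level_set:
  fixes R :: "real poly"
  assumes chain: "deriv_chain {u..v} n F" "n \<ge> 1" "\<And>x. x \<in> {u..v} \<Longrightarrow> F n x \<noteq> 0" and "R \<noteq> 0"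
  shows "finite {x\<in>{u..v}. poly R (F 0 x) = 0}" "card {x\<in>{u..v}. poly R (F 0 x) = 0} \<le> degree R * n"
proof -
  let ?Z = "{c. poly R c = 0}" and ?L = "\<lambda>c. {x\<in>{u..v}. F 0 x = c}"
  have Z: "finite ?Z" "card ?Z \<le> degree R"
    using \<open>R \<noteq> 0\<close> by (auto intro: poly_roots_finite card_poly_roots_bound)
  have eq: "{x\<in>{u..v}. poly R (F 0 x) = 0} = (\<Union>c\<in>?Z. ?L c)" by auto
  show "finite {x\<in>{u..v}. poly R (F 0 x) = 0}"
    unfolding eq using Z deriv_chain_level_set[OF chain] by blast
  have "card (\<Union>c\<in>?Z. ?L c) \<le> (\<Sum>c\<in>?Z. card (?L c))" using Z by (intro card_UN_le)
  also have "\<dots> \<le> (\<Sum>c\<in>?Z. n)" using deriv_chain_level_set[OF chain] by (intro sum_mono) blast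
  also have "\<dots> \<le> degree R * n" using Z by simp
  finally show "card {x\<in>{u..v}. poly R (F 0 x) = 0} \<le> degree R * n" unfolding eq .
qed

subsection \<open>Oscillatory integrals\<close>

text \<open>The integrand is the modulus of the derivative of \<open>1 / q\<close>. As
  \<open>q'\<close> keeps its sign, the integral is the change of \<open>1 / q\<close> between the
  endpoints, up to sign.\<close>

lemma integral_deriv_inverse_bound:
  fixes q q' :: "real \<Rightarrow> real"
  assumes "u \<le> v" "\<delta> > 0"
    and der: "\<And>x. x \<in> {u..v} \<Longrightarrow> (q has_real_derivative q' x) (at x within {u..v})"
    and lower: "\<And>x. x \<in> {u..v} \<Longrightarrow> \<delta> \<le> \<bar>q x\<bar>"
    and sign: "(\<forall>x\<in>{u..v}. 0 \<le> q' x) \<or> (\<forall>x\<in>{u..v}. q' x \<le> 0)"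
  shows "(\<lambda>x. \<bar>q' x\<bar> / (q x)\<^sup>2) integrable_on {u..v}"
    and "integral {u..v} (\<lambda>x. \<bar>q' x\<bar> / (q x)\<^sup>2) \<le> 2 / \<delta>"
proof -
  obtain \<sigma> :: real where \<sigma>: "\<bar>\<sigma>\<bar> = 1" "\<And>x. x \<in> {u..v} \<Longrightarrow> \<sigma> * q' x = \<bar>q' x\<bar>"
  proof (cases "\<forall>x\<in>{u..v}. 0 \<le> q' x")
    case True
    then show ?thesis by (intro that[of 1]) auto
  next
    case False
    then show ?thesis using sign by (intro that[of "-1"]) auto
  qed
  have "((\<lambda>x. \<bar>q' x\<bar> / (q x)\<^sup>2) has_integral (- \<sigma> / q v - - \<sigma> / q u)) {u..v}"
  proof (rule fundamental_theorem_of_calculus[OF \<open>u \<le> v\<close>])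
    fix x assume x: "x \<in> {u..v}"
    then have "q x \<noteq> 0" using lower[of x] \<open>\<delta> > 0\<close> by auto
    then have "((\<lambda>x. - \<sigma> / q x) has_real_derivative \<sigma> * q' x / (q x)\<^sup>2) (at x within {u..v})"
      using der[OF x] by (auto intro!: derivative_eq_intros simp: power2_eq_square)
    then show "((\<lambda>x. - \<sigma> / q x) has_vector_derivative \<bar>q' x\<bar> / (q x)\<^sup>2) (at x within {u..v})"
      using \<sigma>(2)[OF x] by (simp add: has_real_derivative_iff_has_vector_derivative)
  qed
  moreover have "\<bar>\<sigma> / q x\<bar> \<le> 1 / \<delta>" if "x \<in> {u..v}" for x
    using lower[OF that] \<sigma>(1) \<open>\<delta> > 0\<close> by (simp add: abs_divide frac_le)
  then have "- \<sigma> / q v - - \<sigma> / q u \<le> 2 / \<delta>"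
    using \<open>u \<le> v\<close> by (smt (verit) add_divide_distrib atLeastAtMost_iff minus_divide_left)
  ultimately show "(\<lambda>x. \<bar>q' x\<bar> / (q x)\<^sup>2) integrable_on {u..v}"
    and "integral {u..v} (\<lambda>x. \<bar>q' x\<bar> / (q x)\<^sup>2) \<le> 2 / \<delta>"
    by (auto simp: integrable_on_def integral_unique)
qed

lemma norm_exp_i_of_real [simp]: "norm (exp (\<i> * complex_of_real r)) = 1"
  by (simp add: norm_exp_i_times)

text \<open>With \<open>\<psi> = 1 / (q * g)\<close>, the function \<open>\<i> * l * E\<close> is
  the derivative of \<open>E * \<psi>\<close> minus \<open>E * \<psi>'\<close>. The boundary terms
  give 2 and the integral of \<open>\<bar>\<psi>'\<bar>\<close> gives 4, in units of
  \<open>1 / (\<delta> * \<epsilon>)\<close>. The product \<open>q * g\<close> itself need not be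
  monotone.\<close>

lemma oscillatory_integral_bound:
  fixes \<Phi> q g q' g' :: "real \<Rightarrow> real"
  assumes "u \<le> v" and pos: "\<delta> > 0" "\<epsilon> > 0" "l \<noteq> 0"
    and \<Phi>: "\<And>x. x \<in> {u..v} \<Longrightarrow> (\<Phi> has_real_derivative q x * g x) (at x within {u..v})"
    and q: "\<And>x. x \<in> {u..v} \<Longrightarrow> (q has_real_derivative q' x) (at x within {u..v})"
      "\<And>x. x \<in> {u..v} \<Longrightarrow> \<delta> \<le> \<bar>q x\<bar>"
      "(\<forall>x\<in>{u..v}. 0 \<le> q' x) \<or> (\<forall>x\<in>{u..v}. q' x \<le> 0)"
    and g: "\<And>x. x \<in> {u..v} \<Longrightarrow> (g has_real_derivative g' x) (at x within {u..v})"
      "\<And>x. x \<in> {u..v} \<Longrightarrow> \<epsilon> \<le> \<bar>g x\<bar>"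
      "(\<forall>x\<in>{u..v}. 0 \<le> g' x) \<or> (\<forall>x\<in>{u..v}. g' x \<le> 0)"
  shows "norm (integral {u..v} (\<lambda>x. exp (\<i> * complex_of_real (l * \<Phi> x)))) \<le> 6 / (\<bar>l\<bar> * \<delta> * \<epsilon>)"
proof -
  define E where "E x = exp (\<i> * complex_of_real (l * \<Phi> x))" for x
  define \<psi> where "\<psi> x = 1 / (q x * g x)" for x
  define \<psi>' where "\<psi>' x = - (q' x / (q x)\<^sup>2) / g x - (g' x / (g x)\<^sup>2) / q x" for x
  have nz: "q x \<noteq> 0" "g x \<noteq> 0" if "x \<in> {u..v}" for x
    using q(2)[OF that] g(2)[OF that] pos by auto
  have E': "(E has_vector_derivative \<i> * complex_of_real (l * (q x * g x)) * E x) (at x within {u..v})"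
    if x: "x \<in> {u..v}" for x
  proof -
    have "((\<lambda>x. l * \<Phi> x) has_real_derivative l * (q x * g x)) (at x within {u..v})"
      by (intro DERIV_cmult \<Phi> x)
    then have "((\<lambda>x. \<i> * complex_of_real (l * \<Phi> x)) has_vector_derivative
        \<i> * complex_of_real (l * (q x * g x))) (at x within {u..v})"
      by (intro has_vector_derivative_mult_right has_vector_derivative_of_real)
    from field_vector_diff_chain_within[OF this, of exp "E x"] show ?thesis
      by (simp add: E_def[abs_def] o_def DERIV_exp has_field_derivative_at_within)
  qed
  have \<psi>': "(\<psi> has_real_derivative \<psi>' x) (at x within {u..v})" if x: "x \<in> {u..v}" for x
    unfolding \<psi>_def \<psi>'_def using nz[OF x]
    by (auto intro!: derivative_eq_intros q(1)[OF x] g(1)[OF x] simp: field_simps power2_eq_square)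
  \<comment> \<open>Continuity of \<open>q'\<close> and \<open>g'\<close> is not assumed:
    integrability of \<open>E * \<psi>'\<close> comes from that of the full derivative of
    \<open>E * \<psi>\<close> and of the continuous \<open>E\<close>.\<close>
  have ftc: "((\<lambda>x. \<i> * complex_of_real l * E x + E x * complex_of_real (\<psi>' x)) has_integral
      (E v * complex_of_real (\<psi> v) - E u * complex_of_real (\<psi> u))) {u..v}"
  proof (rule fundamental_theorem_of_calculus[OF \<open>u \<le> v\<close>])
    fix x assume x: "x \<in> {u..v}"
    have "complex_of_real (q x * g x * \<psi> x) = 1" using nz[OF x] by (simp add: \<psi>_def)
    moreover have "\<i> * complex_of_real (l * (q x * g x)) * E x * complex_of_real (\<psi> x)
        = \<i> * complex_of_real l * E x * complex_of_real (q x * g x * \<psi> x)"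
      by (simp add: algebra_simps)
    ultimately have "E x * complex_of_real (\<psi>' x) +
        \<i> * complex_of_real (l * (q x * g x)) * E x * complex_of_real (\<psi> x)
        = E x * complex_of_real (\<psi>' x) + \<i> * complex_of_real l * E x"
      by simp
    then show "((\<lambda>x. E x * complex_of_real (\<psi> x)) has_vector_derivative
        \<i> * complex_of_real l * E x + E x * complex_of_real (\<psi>' x)) (at x within {u..v})"
      by (intro has_vector_derivative_eq_rhs[OF has_vector_derivative_mult
            [OF E'[OF x] has_vector_derivative_of_real[OF \<psi>'[OF x]]]]) (simp only: add.commute)
  qed
  have E_int: "E integrable_on {u..v}"
    using E' by (intro integrable_continuous_real continuous_on_vector_derivative) blast
  then have lE: "((\<lambda>x. \<i> * complex_of_real l * E x) has_integral \<i> * complex_of_real l * integral {u..v} E) {u..v}"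
    by (intro has_integral_mult_right integrable_integral)
  have diff: "((\<lambda>x. E x * complex_of_real (\<psi>' x)) has_integral
      (E v * complex_of_real (\<psi> v) - E u * complex_of_real (\<psi> u) - \<i> * complex_of_real l * integral {u..v} E)) {u..v}"
    using has_integral_diff[OF ftc lE] by simp
  let ?I = "integral {u..v} (\<lambda>x. E x * complex_of_real (\<psi>' x))"
  note Aq = integral_deriv_inverse_bound[OF \<open>u \<le> v\<close> pos(1) q]
  note Ag = integral_deriv_inverse_bound[OF \<open>u \<le> v\<close> pos(2) g]
  have "norm ?I \<le> integral {u..v} (\<lambda>x. \<bar>q' x\<bar> / (q x)\<^sup>2 * (1 / \<epsilon>) + \<bar>g' x\<bar> / (g x)\<^sup>2 * (1 / \<delta>))"
  proof (rule integral_norm_bound_integral)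
    show "(\<lambda>x. E x * complex_of_real (\<psi>' x)) integrable_on {u..v}"
      using diff by blast
    show "(\<lambda>x. \<bar>q' x\<bar> / (q x)\<^sup>2 * (1 / \<epsilon>) + \<bar>g' x\<bar> / (g x)\<^sup>2 * (1 / \<delta>)) integrable_on {u..v}"
      by (intro integrable_add integrable_on_mult_left Aq(1) Ag(1))
    fix x assume x: "x \<in> {u..v}"
    have "norm (E x * complex_of_real (\<psi>' x)) = \<bar>\<psi>' x\<bar>" by (simp add: norm_mult E_def)
    also have "\<dots> \<le> \<bar>q' x / (q x)\<^sup>2 / g x\<bar> + \<bar>g' x / (g x)\<^sup>2 / q x\<bar>"
      unfolding \<psi>'_def minus_divide_left[symmetric] by linarith
    also have "\<dots> = \<bar>q' x\<bar> / (q x)\<^sup>2 * (1 / \<bar>g x\<bar>) + \<bar>g' x\<bar> / (g x)\<^sup>2 * (1 / \<bar>q x\<bar>)"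
      by (simp add: abs_divide abs_mult)
    also have "\<dots> \<le> \<bar>q' x\<bar> / (q x)\<^sup>2 * (1 / \<epsilon>) + \<bar>g' x\<bar> / (g x)\<^sup>2 * (1 / \<delta>)"
      using q(2)[OF x] g(2)[OF x] pos by (intro add_mono mult_left_mono) (auto simp: frac_le)
    finally show "norm (E x * complex_of_real (\<psi>' x)) \<le> \<dots>" .
  qed
  also have "\<dots> = integral {u..v} (\<lambda>x. \<bar>q' x\<bar> / (q x)\<^sup>2) * (1 / \<epsilon>)
      + integral {u..v} (\<lambda>x. \<bar>g' x\<bar> / (g x)\<^sup>2) * (1 / \<delta>)"
    using Aq(1) Ag(1)
    by (subst integral_add) (auto simp only: integral_mult_left integrable_on_mult_left)
  also have "\<dots> \<le> 2 / \<delta> * (1 / \<epsilon>) + 2 / \<epsilon> * (1 / \<delta>)"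
    using Aq(2) Ag(2) pos by (intro add_mono mult_right_mono) auto
  finally have I: "norm ?I \<le> 4 / (\<delta> * \<epsilon>)" by (simp add: mult.commute)
  have bd: "norm (E x * complex_of_real (\<psi> x)) \<le> 1 / (\<delta> * \<epsilon>)" if x: "x \<in> {u..v}" for x
  proof -
    have "\<delta> * \<epsilon> \<le> \<bar>q x * g x\<bar>" unfolding abs_mult using q(2)[OF x] g(2)[OF x] pos by (intro mult_mono) auto
    then have "1 / \<bar>q x * g x\<bar> \<le> 1 / (\<delta> * \<epsilon>)" using pos by (intro frac_le) auto
    moreover have "norm (E x) = 1" unfolding E_def by (rule norm_exp_i_of_real)
    ultimately show ?thesis by (simp only: norm_mult norm_of_real \<psi>_def abs_divide abs_one mult_1)
  qed
  have "\<i> * complex_of_real l * integral {u..v} E =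
      E v * complex_of_real (\<psi> v) - E u * complex_of_real (\<psi> u) - ?I"
    using integral_unique[OF diff] by simp
  then have "\<bar>l\<bar> * norm (integral {u..v} E) =
      norm (E v * complex_of_real (\<psi> v) - E u * complex_of_real (\<psi> u) - ?I)"
    by (metis norm_ii norm_mult norm_of_real mult_1)
  also have "\<dots> \<le> norm (E v * complex_of_real (\<psi> v)) + norm (E u * complex_of_real (\<psi> u)) + norm ?I"
    by (meson add_mono_thms_linordered_semiring(3) norm_triangle_ineq4 order_trans)
  also have "\<dots> \<le> 6 / (\<delta> * \<epsilon>)"
    using bd[of u] bd[of v] I \<open>u \<le> v\<close> by (simp add: algebra_simps)
  finally show ?thesis using pos unfolding E_def by (simp add: field_simps)
qed

section \<open>The estimate on one piece, and the summation over pieces\<close>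

lemma smooth_within_deriv_chain:
  assumes "smooth_within {a..b} f" "a < b"
  shows "deriv_chain {a..b} n (\<lambda>i. nth_deriv_within {a..b} i f)"
  unfolding deriv_chain_def
proof (intro allI impI ballI)
  fix i x assume "x \<in> {a..b}"
  then have "nth_deriv_within {a..b} i f differentiable (at x within {a..b})"
    using assms(1) by (auto simp: smooth_within_def differentiable_on_def)
  then show "(nth_deriv_within {a..b} i f has_real_derivative nth_deriv_within {a..b} (Suc i) f x)
      (at x within {a..b})"
    by (simp add: has_real_derivative_iff_has_vector_derivative vector_derivative_works)
qed

lemma deriv_nonneg_of_mono_on:
  fixes g g' :: "real \<Rightarrow> real"
  assumes "a < b" "mono_on {a..b} g" "continuous_on {a..b} g'"
    and der: "\<And>x. x \<in> {a..b} \<Longrightarrow> (g has_real_derivative g' x) (at x within {a..b})"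
    and x: "x \<in> {a..b}"
  shows "0 \<le> g' x"
proof -
  have "0 \<le> g' y" if y: "y \<in> {a<..<b}" for y
  proof (rule mono_on_imp_deriv_nonneg[OF assms(2)])
    show "(g has_real_derivative g' y) (at y)"
      using der[of y] y by (simp add: at_within_Icc_at)
  qed (use y in simp)
  moreover have "closure {a<..<b} = {a..b}" using \<open>a < b\<close> by simp
  ultimately show ?thesis
    using continuous_ge_on_closure[of "{a<..<b}" g' x 0] assms(3) x by metis
qed

text \<open>The normalisation of \<open>\<tau>\<close> balances the cases: each contributes a
  multiple of \<open>\<tau>\<close>. For \<open>N = 1\<close> the break points say nothing about
  \<open>F 1\<close> and \<open>F 2\<close>; the lower bound on \<open>\<bar>F 1\<bar>\<close> and
  the monotonicity of \<open>F 1\<close> replace them.\<close>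

lemma oscillatory_integral_piece:
  fixes F :: "nat \<Rightarrow> real \<Rightarrow> real" and P :: "real poly"
  assumes chain: "\<And>n. deriv_chain {u..v} n F" and "u < v" "N \<ge> 1"
    and lower: "\<And>x. x \<in> {u..v} \<Longrightarrow> 1 \<le> \<bar>F N x\<bar>"
    and N1: "N = 1 \<Longrightarrow> (\<forall>x\<in>{u..v}. 0 \<le> F 2 x) \<or> (\<forall>x\<in>{u..v}. F 2 x \<le> 0)"
    and sublevel: "\<And>s t. s \<le> t \<Longrightarrow> (\<forall>x\<in>{s..t}. \<bar>poly (pderiv P) x\<bar> \<le> \<tau> ^ (N * m)) \<Longrightarrow> t - s \<le> K * \<tau> ^ N"
    and "K \<ge> 0" and \<tau>: "\<tau> > 0" "\<tau> ^ (N * (m + 1)) * \<bar>l\<bar> = 1"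
    and break1: "\<And>x. N \<ge> 2 \<Longrightarrow> x \<in> {u<..<v} \<Longrightarrow> F 2 x \<noteq> 0 \<and> \<bar>F 1 x\<bar> \<noteq> \<tau> ^ (N - 1)"
    and break2: "\<And>x. x \<in> {u<..<v} \<Longrightarrow>
      poly (pderiv (pderiv P)) (F 0 x) \<noteq> 0 \<and> \<bar>poly (pderiv P) (F 0 x)\<bar> \<noteq> \<tau> ^ (N * m)"
  shows "norm (integral {u..v} (\<lambda>x. exp (\<i> * complex_of_real (l * poly P (F 0 x)))))
           \<le> (6 + 2 * real N * (1 + K)) * \<tau>"
proof -
  let ?Q = "pderiv P"
  let ?g = "\<lambda>x. exp (\<i> * complex_of_real (l * poly P (F 0 x)))"
  have der: "(F i has_real_derivative F (Suc i) x) (at x within {u..v})" if "x \<in> {u..v}" for i x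
    using chain[of "Suc i"] that by (simp add: deriv_chain_def)
  have cont: "continuous_on {u..v} (F i)" for i
    using der by (rule DERIV_continuous_on)
  have cont_poly: "continuous_on {u..v} (\<lambda>x. poly R (F 0 x))" for R
    by (intro continuous_intros cont)
  \<comment> \<open>The integrand has modulus 1, so a short piece needs no cancellation.\<close>
  have short: ?thesis if "v - u \<le> 2 * real N * (1 + K) * \<tau>"
  proof -
    have "continuous_on {u..v} ?g" by (intro continuous_intros cont)
    then have "norm (integral {u..v} ?g) \<le> 1 * (v - u)"
      using \<open>u < v\<close> by (intro integral_bound) auto
    also have "\<dots> \<le> (6 + 2 * real N * (1 + K)) * \<tau>"
      using that \<tau>(1) by (simp add: algebra_simps)
    finally show ?thesis .
  qed
  consider (small_deriv) "N \<ge> 2" "\<forall>x\<in>{u..v}. \<bar>F 1 x\<bar> \<le> \<tau> ^ (N - 1)"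
    | (small_poly) "\<forall>x\<in>{u..v}. \<bar>poly ?Q (F 0 x)\<bar> \<le> \<tau> ^ (N * m)"
    | (large) "\<forall>x\<in>{u..v}. \<tau> ^ (N - 1) \<le> \<bar>F 1 x\<bar>" "\<forall>x\<in>{u..v}. \<tau> ^ (N * m) \<le> \<bar>poly ?Q (F 0 x)\<bar>"
  proof -
    have "(\<forall>x\<in>{u..v}. 0 \<le> \<bar>poly ?Q (F 0 x)\<bar> - \<tau> ^ (N * m)) \<or>
          (\<forall>x\<in>{u..v}. \<bar>poly ?Q (F 0 x)\<bar> - \<tau> ^ (N * m) \<le> 0)"
      using break2 \<open>u < v\<close> by (intro continuous_nonzero_sign continuous_intros cont_poly) auto
    \<comment> \<open>For \<open>N = 1\<close> the threshold is \<open>\<tau> ^ 0 = 1\<close>, which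
      is the assumed lower bound.\<close>
    moreover have "(\<forall>x\<in>{u..v}. \<tau> ^ (N - 1) \<le> \<bar>F 1 x\<bar>) \<or> N \<ge> 2 \<and> (\<forall>x\<in>{u..v}. \<bar>F 1 x\<bar> \<le> \<tau> ^ (N - 1))"
    proof (cases "N = 1")
      case True
      then show ?thesis using lower by simp
    next
      case False
      then have "N \<ge> 2" using \<open>N \<ge> 1\<close> by simp
      then have "(\<forall>x\<in>{u..v}. 0 \<le> \<bar>F 1 x\<bar> - \<tau> ^ (N - 1)) \<or> (\<forall>x\<in>{u..v}. \<bar>F 1 x\<bar> - \<tau> ^ (N - 1) \<le> 0)"
        using break1 \<open>u < v\<close> by (intro continuous_nonzero_sign continuous_intros cont) auto
      then show ?thesis using \<open>N \<ge> 2\<close> by auto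
    qed
    ultimately show thesis using that by (smt (verit))
  qed
  then show ?thesis
  proof cases
    case small_deriv
    \<comment> \<open>Started at \<open>F 1\<close>, the chain reaches \<open>F N\<close> after
      \<open>N - 1\<close> derivatives, matching the threshold
      \<open>\<tau> ^ (N - 1)\<close>.\<close>
    have "deriv_chain {u..v} (N - 1) (\<lambda>i. F (i + 1))"
      using chain[of N] small_deriv(1) by (intro deriv_chain_shift_index[of _ N]) auto
    then have "v - u \<le> 2 * real (N - 1) * \<tau>"
      using small_deriv \<open>u < v\<close> \<tau>(1) lower
      by (intro interval_length_le[where A = 1 and F = "\<lambda>i. F (i + 1)"]) auto
    also have "\<dots> \<le> 2 * real N * \<tau>" using \<tau>(1) by (intro mult_mono) auto
    also have "\<dots> \<le> 2 * real N * (1 + K) * \<tau>"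
      using \<tau>(1) \<open>K \<ge> 0\<close> by (simp add: algebra_simps)
    finally show ?thesis by (rule short)
  next
    case small_poly
    have near: "\<bar>F 0 x - F 0 u\<bar> \<le> K * \<tau> ^ N" if x: "x \<in> {u..v}" for x
    proof -
      let ?s = "min (F 0 u) (F 0 x)" and ?t = "max (F 0 u) (F 0 x)"
      have conn: "connected (F 0 ` {u..v})"
        by (intro connected_continuous_image cont) auto
      have mem: "?s \<in> F 0 ` {u..v}" "?t \<in> F 0 ` {u..v}"
        using x \<open>u < v\<close> by (auto simp: min_def max_def)
      \<comment> \<open>By connectedness every value between \<open>F 0 u\<close> and
        \<open>F 0 x\<close> is attained on the piece, where \<open>?Q\<close> is small at the
        values of \<open>F 0\<close>.\<close>
      have "\<forall>y\<in>{?s..?t}. \<bar>poly ?Q y\<bar> \<le> \<tau> ^ (N * m)"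
      proof
        fix y assume "y \<in> {?s..?t}"
        then have "y \<in> F 0 ` {u..v}" using connectedD_interval[OF conn mem, of y] by simp
        then show "\<bar>poly ?Q y\<bar> \<le> \<tau> ^ (N * m)" using small_poly by auto
      qed
      then have "?t - ?s \<le> K * \<tau> ^ N" by (intro sublevel) auto
      then show ?thesis by linarith
    qed
    \<comment> \<open>This turns the bound into an \<open>N\<close>-th power, with
      \<open>r = (1 + K) * \<tau>\<close> for \<open>interval_length_le\<close>.\<close>
    have "K * \<tau> ^ N \<le> (1 + K) ^ N * \<tau> ^ N"
    proof (intro mult_right_mono)
      have "(1 + K) ^ 1 \<le> (1 + K) ^ N" using \<open>N \<ge> 1\<close> \<open>K \<ge> 0\<close> by (intro power_increasing) auto
      then show "K \<le> (1 + K) ^ N" by simp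
    qed (use \<tau> in auto)
    then have "\<bar>F 0 x - F 0 u\<bar> \<le> ((1 + K) * \<tau>) ^ N" if "x \<in> {u..v}" for x
      using near[OF that] by (simp add: power_mult_distrib)
    then have "v - u \<le> 2 * real N * ((1 + K) * \<tau>)"
      using \<open>N \<ge> 1\<close> \<open>u < v\<close> \<tau>(1) \<open>K \<ge> 0\<close> lower
      by (intro interval_length_le[OF deriv_chain_diff_const[OF chain, of N "F 0 u"], where A = 1]) auto
    then show ?thesis by (intro short) (simp add: mult.assoc)
  next
    case large
    have "norm (integral {u..v} ?g) \<le> 6 / (\<bar>l\<bar> * \<tau> ^ (N * m) * \<tau> ^ (N - 1))"
    proof (rule oscillatory_integral_bound[where q = "\<lambda>x. poly ?Q (F 0 x)" and g = "F 1"
          and q' = "\<lambda>x. poly (pderiv ?Q) (F 0 x) * F 1 x" and g' = "F 2"])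
      show "l \<noteq> 0" using \<tau>(2) by auto
      show "(\<forall>x\<in>{u..v}. 0 \<le> F 2 x) \<or> (\<forall>x\<in>{u..v}. F 2 x \<le> 0)"
      proof (cases "N = 1")
        case False
        then show ?thesis
          using break1 \<open>u < v\<close> \<open>N \<ge> 1\<close> by (intro continuous_nonzero_sign cont) auto
      qed (use N1 in blast)
      \<comment> \<open>The derivative of \<open>?Q\<close> along \<open>F 0\<close> has the factor
        \<open>F 1\<close>, which must not vanish for the product to keep its sign.\<close>
      have "F 1 x \<noteq> 0" if "x \<in> {u..v}" for x
        using large(1) that \<tau>(1) by (metis abs_zero not_less zero_less_power)
      then show "(\<forall>x\<in>{u..v}. 0 \<le> poly (pderiv ?Q) (F 0 x) * F 1 x) \<or>
          (\<forall>x\<in>{u..v}. poly (pderiv ?Q) (F 0 x) * F 1 x \<le> 0)"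
        using break2 \<open>u < v\<close> by (intro continuous_nonzero_sign continuous_intros cont) auto
      fix x assume x: "x \<in> {u..v}"
      show "(F 1 has_real_derivative F 2 x) (at x within {u..v})"
        using der[OF x, of 1] by (simp add: numeral_2_eq_2)
      have chain_rule: "((\<lambda>x. poly R (F 0 x)) has_real_derivative poly (pderiv R) (F 0 x) * F 1 x)
          (at x within {u..v})" for R
        using DERIV_chain2[OF poly_DERIV der[OF x, of 0]] by simp
      show "((\<lambda>x. poly P (F 0 x)) has_real_derivative poly ?Q (F 0 x) * F 1 x) (at x within {u..v})"
        and "((\<lambda>x. poly ?Q (F 0 x)) has_real_derivative poly (pderiv ?Q) (F 0 x) * F 1 x) (at x within {u..v})"
        by (rule chain_rule)+
    qed (use large \<tau> \<open>u < v\<close> in auto)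
    also have "\<dots> = 6 * \<tau>"
    proof -
      have "N * (m + 1) = N * m + (N - 1) + 1" using \<open>N \<ge> 1\<close> by simp
      then have "\<tau> * (\<bar>l\<bar> * \<tau> ^ (N * m) * \<tau> ^ (N - 1)) = 1"
        using \<tau>(2) by (simp only: power_add power_one_right mult_ac)
      then have "\<bar>l\<bar> * \<tau> ^ (N * m) * \<tau> ^ (N - 1) = 1 / \<tau>"
        using \<tau>(1) by (simp only: eq_divide_eq mult.commute) simp
      then show ?thesis by simp
    qed
    also have "\<dots> \<le> (6 + 2 * real N * (1 + K)) * \<tau>"
      using \<tau>(1) \<open>K \<ge> 0\<close> by (intro mult_right_mono) auto
    finally show ?thesis .
  qed
qed

theorem proposition2p2:
  fixes d N :: nat
  assumes "d \<ge> 2" and "N \<ge> 1"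
  shows "\<exists>C::real. \<forall>(a::real) (b::real) (f::real \<Rightarrow> real).
    a < b \<longrightarrow>
    smooth_within {a..b} f \<longrightarrow>
    (\<forall>x\<in>{a..b}. \<bar>nth_deriv_within {a..b} N f x\<bar> \<ge> 1) \<longrightarrow>
    (N = 1 \<longrightarrow> mono_on {a..b} (nth_deriv_within {a..b} 1 f) \<or>
              antimono_on {a..b} (nth_deriv_within {a..b} 1 f)) \<longrightarrow>
    (\<forall>(P::real poly) (l::real).
       degree P = d \<longrightarrow> (monic (pderiv P) \<or> SND (pderiv P)) \<longrightarrow> \<bar>l\<bar> \<ge> 1 \<longrightarrow>
       norm (integral {a..b} (\<lambda>x. exp (\<i> * complex_of_real (l * poly P (f x)))))
         \<le> C * \<bar>l\<bar> powr (- 1 / (real N * real d)))"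
proof -
  define m where "m = d - 1"
  have m: "m \<ge> 1" "m + 1 = d" using \<open>d \<ge> 2\<close> by (auto simp: m_def)
  obtain K where "K > 0" and K: "\<And>(Q::real poly) s t \<rho>. degree Q = m \<Longrightarrow> monic Q \<or> SND Q \<Longrightarrow>
      0 \<le> \<rho> \<Longrightarrow> \<rho> \<le> 1 \<Longrightarrow> s \<le> t \<Longrightarrow> (\<forall>x\<in>{s..t}. \<bar>poly Q x\<bar> \<le> \<rho> ^ m) \<Longrightarrow> t - s \<le> K * \<rho>"
    using sublevel_interval[OF m(1)] by blast
  define B where "B = 6 + 2 * real N * (1 + K)"
  \<comment> \<open>At most \<open>3 * N\<close> break points come from \<open>F 1\<close> and
    \<open>F 2\<close>, at most \<open>3 * m * N\<close> from the polynomial \<open>R\<close>; one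
    more than their number bounds the number of pieces.\<close>
  define C where "C = (real (3 * N + 3 * m * N) + 1) * B"
  have "norm (integral {a..b} (\<lambda>x. exp (\<i> * complex_of_real (l * poly P (f x)))))
      \<le> C * \<bar>l\<bar> powr (- 1 / (real N * real d))"
    if "a < b" and smooth: "smooth_within {a..b} f"
      and lower: "\<forall>x\<in>{a..b}. \<bar>nth_deriv_within {a..b} N f x\<bar> \<ge> 1"
      and mono: "N = 1 \<longrightarrow> mono_on {a..b} (nth_deriv_within {a..b} 1 f) \<or>
              antimono_on {a..b} (nth_deriv_within {a..b} 1 f)"
      and deg: "degree P = d" and Q: "monic (pderiv P) \<or> SND (pderiv P)" and l: "\<bar>l\<bar> \<ge> 1"
    for a b :: real and f P l
  proof -
    define \<tau> where "\<tau> = \<bar>l\<bar> powr (- 1 / (real N * real d))"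
    have "\<tau> > 0" using l by (auto simp: \<tau>_def)
    \<comment> \<open>The sublevel estimate is applied with \<open>\<rho> = \<tau> ^ N\<close> and
      requires \<open>\<rho> \<le> 1\<close>; here \<open>\<bar>l\<bar> \<ge> 1\<close>
      enters.\<close>
    have "\<tau> \<le> \<bar>l\<bar> powr 0"
      unfolding \<tau>_def using l by (intro powr_mono) (auto simp: divide_nonpos_nonneg)
    then have "\<tau> \<le> 1" using l by (simp split: if_splits)
    have "\<tau> ^ (N * (m + 1)) = \<tau> powr (real N * real d)"
      using \<open>\<tau> > 0\<close> unfolding m(2) by (simp flip: powr_realpow)
    also have "\<dots> = \<bar>l\<bar> powr (- 1)" using assms by (simp add: \<tau>_def powr_powr)
    finally have \<tau>l: "\<tau> ^ (N * (m + 1)) * \<bar>l\<bar> = 1" using l by (simp add: powr_minus_divide)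
    define F where "F i = nth_deriv_within {a..b} i f" for i
    have F0: "F 0 = f" by (simp add: F_def)
    have chain: "deriv_chain {a..b} n F" for n
      using smooth_within_deriv_chain[OF smooth \<open>a < b\<close>] by (simp add: F_def[abs_def])
    have lowerF: "1 \<le> \<bar>F N x\<bar>" if "x \<in> {a..b}" for x using lower that by (simp add: F_def)
    have der: "(F i has_real_derivative F (Suc i) x) (at x within {a..b})" if "x \<in> {a..b}" for i x
      using chain[of "Suc i"] that by (simp add: deriv_chain_def)
    have cont: "continuous_on {a..b} (F i)" for i
      using der by (rule DERIV_continuous_on)
    have sign: "(\<forall>x\<in>{a..b}. 0 \<le> F 2 x) \<or> (\<forall>x\<in>{a..b}. F 2 x \<le> 0)" if "N = 1"
    proof -
      have der2: "(F 1 has_real_derivative F 2 x) (at x within {a..b})" if "x \<in> {a..b}" for x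
        using der[OF that, of 1] by (simp add: numeral_2_eq_2)
      from mono \<open>N = 1\<close> consider "mono_on {a..b} (F 1)" | "antimono_on {a..b} (F 1)"
        by (auto simp: F_def)
      then show ?thesis
      proof cases
        case 1
        then show ?thesis using deriv_nonneg_of_mono_on[OF \<open>a < b\<close> 1 cont der2] by blast
      next
        case 2
        then have mono': "mono_on {a..b} (\<lambda>x. - F 1 x)" by (auto simp: monotone_on_def)
        have "0 \<le> - F 2 x" if "x \<in> {a..b}" for x
          by (rule deriv_nonneg_of_mono_on[OF \<open>a < b\<close> mono' _ DERIV_minus[OF der2] that])
            (intro continuous_intros cont)
        then show ?thesis by auto
      qed
    qed
    \<comment> \<open>The roots of \<open>R\<close> are the critical points of
      \<open>pderiv P\<close> and the points where it equals plus or minus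
      \<open>\<tau> ^ (N * m)\<close>.\<close>
    define R where "R = pderiv (pderiv P) * ((pderiv P)\<^sup>2 - [:(\<tau> ^ (N * m))\<^sup>2:])"
    have degQ: "degree (pderiv P) = m" using deg by (simp add: degree_pderiv m_def)
    have R: "R \<noteq> 0" "degree R \<le> 3 * m"
    proof -
      have "pderiv (pderiv P) \<noteq> 0" using degQ m by (simp add: pderiv_eq_0_iff)
      moreover have "(pderiv P)\<^sup>2 - [:(\<tau> ^ (N * m))\<^sup>2:] \<noteq> 0"
      proof
        assume "(pderiv P)\<^sup>2 - [:(\<tau> ^ (N * m))\<^sup>2:] = 0"
        then have "degree ((pderiv P)\<^sup>2) = 0" by (metis degree_pCons_0 eq_iff_diff_eq_0)
        moreover have "pderiv P \<noteq> 0" using degQ m(1) by auto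
        ultimately show False using degQ m(1) by (simp add: degree_power_eq)
      qed
      ultimately show "R \<noteq> 0" by (simp add: R_def)
      have "degree ((pderiv P)\<^sup>2 - [:(\<tau> ^ (N * m))\<^sup>2:]) \<le> 2 * m"
        using degQ by (intro degree_diff_le) (auto intro: order_trans[OF degree_power_le])
      moreover have "degree (pderiv (pderiv P)) \<le> m" using degQ by (simp add: degree_pderiv)
      ultimately show "degree R \<le> 3 * m"
        unfolding R_def by (intro order_trans[OF degree_mult_le]) linarith
    qed
    define S1 where "S1 = {x\<in>{a..b}. F 2 x = 0} \<union> {x\<in>{a..b}. F 1 x = \<tau> ^ (N - 1)} \<union>
      {x\<in>{a..b}. F 1 x = - (\<tau> ^ (N - 1))}"
    define S2 where "S2 = {x\<in>{a..b}. poly R (F 0 x) = 0}"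
    \<comment> \<open>For \<open>N = 1\<close> the set \<open>S1\<close> is left out:
      \<open>F 2\<close> may then vanish on a whole interval.\<close>
    define S where "S = (if N \<ge> 2 then S1 else {}) \<union> S2"
    have nz: "F N x \<noteq> 0" if "x \<in> {a..b}" for x using lowerF[OF that] by auto
    have S1: "finite S1 \<and> card S1 \<le> 3 * N" if "N \<ge> 2"
    proof -
      have lev: "finite {x\<in>{a..b}. F 1 x = c} \<and> card {x\<in>{a..b}. F 1 x = c} \<le> N" for c
        using deriv_chain_level_set[OF deriv_chain_shift_index[OF chain[of N], of "N - 1" 1], of c] nz that
        by (simp add: order_trans[of _ "N - 1" N])
      have zeros: "finite {x\<in>{a..b}. F 2 x = 0} \<and> card {x\<in>{a..b}. F 2 x = 0} \<le> N"
      proof -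
        \<comment> \<open>For \<open>N = 2\<close> this is 0 and \<open>F 2\<close> has no zeros at
          all; \<open>deriv_chain_zeros\<close> covers that case, whereas
          \<open>deriv_chain_level_set\<close> would require a positive length.\<close>
        define k where "k = N - 2"
        have k: "N = k + 2" using that by (simp add: k_def)
        have "deriv_chain {a..b} k (\<lambda>i. F (i + 2))"
          by (rule deriv_chain_shift_index[OF chain[of N]]) (simp add: k)
        moreover have "F (k + 2) x \<noteq> 0" if "x \<in> {a..b}" for x using nz[OF that] k by simp
        ultimately have "finite {x\<in>{a..b}. F (0 + 2) x = 0} \<and> card {x\<in>{a..b}. F (0 + 2) x = 0} \<le> k"
          by (rule deriv_chain_zeros)
        then show ?thesis unfolding k add_0 by linarith
      qed
      have "card S1 \<le> (card {x\<in>{a..b}. F 2 x = 0} + card {x\<in>{a..b}. F 1 x = \<tau> ^ (N - 1)}) +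
          card {x\<in>{a..b}. F 1 x = - (\<tau> ^ (N - 1))}"
        unfolding S1_def by (intro order_trans[OF card_Un_le] add_right_mono card_Un_le)
      then show ?thesis
        using zeros lev[of "\<tau> ^ (N - 1)"] lev[of "- (\<tau> ^ (N - 1))"] by (auto simp: S1_def)
    qed
    have S2: "finite S2 \<and> card S2 \<le> 3 * m * N"
      using deriv_chain_poly_level_set[OF chain \<open>N \<ge> 1\<close> nz R(1)] mult_le_mono1[OF R(2), of N]
      unfolding S2_def by (meson order_trans)
    have S: "finite S" "card S \<le> 3 * N + 3 * m * N"
    proof -
      show "finite S" using S1 S2 by (auto simp: S_def)
      have "card S \<le> card (if N \<ge> 2 then S1 else {}) + card S2" unfolding S_def by (rule card_Un_le)
      also have "\<dots> \<le> 3 * N + 3 * m * N" using S1 S2 by (intro add_mono) auto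
      finally show "card S \<le> 3 * N + 3 * m * N" .
    qed
    have "B > 0" using \<open>K > 0\<close> by (simp add: B_def add_pos_nonneg)
    have "norm (integral {a..b} (\<lambda>x. exp (\<i> * complex_of_real (l * poly P (F 0 x)))))
        \<le> (real (card S) + 1) * (B * \<tau>)"
    proof (rule norm_integral_le_pieces[OF S(1)])
      show "continuous_on {a..b} (\<lambda>x. exp (\<i> * complex_of_real (l * poly P (F 0 x))))"
        by (intro continuous_intros cont)
      fix u v assume uv: "a \<le> u" "u < v" "v \<le> b" and disj: "{u<..<v} \<inter> S = {}"
      then have sub: "{u..v} \<subseteq> {a..b}" by auto
      show "norm (integral {u..v} (\<lambda>x. exp (\<i> * complex_of_real (l * poly P (F 0 x))))) \<le> B * \<tau>"
        unfolding B_def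
      proof (rule oscillatory_integral_piece[OF deriv_chain_subset[OF chain sub] \<open>u < v\<close> \<open>N \<ge> 1\<close>])
        show "1 \<le> \<bar>F N x\<bar>" if "x \<in> {u..v}" for x using lowerF sub that by blast
        show "(\<forall>x\<in>{u..v}. 0 \<le> F 2 x) \<or> (\<forall>x\<in>{u..v}. F 2 x \<le> 0)" if "N = 1"
          using sign[OF that] sub by blast
        show "t - s \<le> K * \<tau> ^ N"
          if "s \<le> t" "\<forall>x\<in>{s..t}. \<bar>poly (pderiv P) x\<bar> \<le> \<tau> ^ (N * m)" for s t
          using that \<open>\<tau> > 0\<close> \<open>\<tau> \<le> 1\<close>
          by (intro K[OF degQ Q]) (auto simp: power_le_one power_mult)
        fix x assume x: "x \<in> {u<..<v}"
        then have notin: "x \<notin> S" "x \<in> {a..b}" using disj uv by auto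
        show "F 2 x \<noteq> 0 \<and> \<bar>F 1 x\<bar> \<noteq> \<tau> ^ (N - 1)" if "N \<ge> 2"
          using notin that unfolding S_def S1_def by (auto simp: abs_if split: if_splits)
        have "poly R (F 0 x) \<noteq> 0" using notin by (auto simp: S_def S2_def)
        then show "poly (pderiv (pderiv P)) (F 0 x) \<noteq> 0 \<and> \<bar>poly (pderiv P) (F 0 x)\<bar> \<noteq> \<tau> ^ (N * m)"
          by (auto simp: R_def) (metis power2_abs)+
      qed (use \<open>K > 0\<close> \<open>\<tau> > 0\<close> \<tau>l in auto)
    qed (use \<open>a < b\<close> \<open>B > 0\<close> \<open>\<tau> > 0\<close> in auto)
    also have "\<dots> \<le> (real (3 * N + 3 * m * N) + 1) * (B * \<tau>)"
      using S(2) \<open>B > 0\<close> \<open>\<tau> > 0\<close> by (intro mult_right_mono) (auto simp flip: of_nat_add of_nat_mult)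
    finally show ?thesis by (simp add: C_def \<tau>_def F0 mult.assoc)
  qed
  then show ?thesis by (intro exI[of _ C]) blast
qed

end
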